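(* Let $Y$ be a random variable whose moment generating function $E[e^{tY}]$ exists for $|t|<r$, for some $r>0$, and define $B_{n}^{(c,Y)}(x)$ by $$e^{x(E[e^{\frac{Y}{2}t}]-E[e^{-\frac{Y}{2}t}])}= \sum_{n=0}^{\infty}B_{n}^{(c,Y)}(x)\frac{t^{n}}{n!}.$$ For $m\ge1$ let $a_m(x)=\frac{x(1-(-1)^{m})}{2^{m}}E[Y^{m}]$ (so $a_1=xE[Y]$, $a_2=0$, $a_3=\frac{x}{2^2}E[Y^3]$, $a_4=0,\dots$). Then for every $n\ge 0$, $$B_{n}^{(c,Y)}(x)=\sum_{k=0}^{n}B_{n,k}\big(a_1(x),a_2(x),\dots,a_{n-k+1}(x)\big).$$
   Context: The partial Bell polynomials $B_{n,k}$ are defined by $\frac{1}{k!}\big(\sum_{m=1}^{\infty}x_{m}\frac{t^{m}}{m!}\big)^{k}=\sum_{n=k}^{\infty}B_{n,k}(x_{1},\dots,x_{n-k+1})\frac{t^{n}}{n!}$; explicitly $B_{n,k}(x_1,\dots,x_{n-k+1})=\sum \frac{n!}{l_1!\cdots l_{n-k+1}!}\prod_{i}\big(\frac{x_i}{i!}\big)^{l_i}$, summed over $l_1+\cdots+l_{n-k+1}=k$, $\sum_i i\,l_i=n$. *)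

theory Defs
  imports "HOL-Probability.Probability" "HOL-Computational_Algebra.Formal_Power_Series"
begin

text \<open>
  The partial Bell polynomial $B_{n,k}$, read off as $n!$ times the coefficient of $t^n$ in
  $\frac{1}{k!} (\sum_{m \ge 1} x_m t^m / m!)^k$. The variables are passed as a sequence
  \<open>x\<close>; only \<open>x 1, \<dots>, x (n - k + 1)\<close> enter, see \<open>partial_bell_cong\<close> below
  (in particular \<open>x 0\<close> is ignored).
\<close>

definition partial_bell :: "nat \<Rightarrow> nat \<Rightarrow> (nat \<Rightarrow> real) \<Rightarrow> real" where
  "partial_bell n k x =
     fact n * fps_nth (fps_const (1 / fact k) *
       Abs_fps (\<lambda>m. if m = 0 then 0 else x m / fact m) ^ k) n"

lemma partial_bell_cong:
  assumes "\<And>i. 1 \<le> i \<Longrightarrow> i \<le> n - k + 1 \<Longrightarrow> x i = y i"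
  shows "partial_bell n k x = partial_bell n k y"
proof -
  let ?F = "\<lambda>x. Abs_fps (\<lambda>m. if m = 0 then 0 else x m / fact m :: real)"
  have shift: "?F z = fps_X * Abs_fps (\<lambda>m. z (Suc m) / fact (Suc m))" for z
    by (rule fps_ext) (auto simp: gr0_conv_Suc)
  have pw: "fps_nth (a ^ j) i = fps_nth (b ^ j) i"
    if "\<And>i. i \<le> N \<Longrightarrow> fps_nth a i = fps_nth b i" "i \<le> N" for a b :: "real fps" and N i j
    using that(2)
  proof (induction j arbitrary: i)
    case (Suc j)
    then show ?case using that(1)
      by (auto simp: fps_mult_nth intro!: sum.cong)
  qed simp
  have "fps_nth (?F x ^ k) n = fps_nth (?F y ^ k) n"
  proof (cases "n < k")
    case True
    then show ?thesis by (simp add: shift power_mult_distrib fps_X_power_mult_nth)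
  next
    case False
    have "fps_nth (Abs_fps (\<lambda>m. x (Suc m) / fact (Suc m)) ^ k) (n - k)
        = fps_nth (Abs_fps (\<lambda>m. y (Suc m) / fact (Suc m)) ^ k) (n - k)"
      by (rule pw[where N = "n - k"]) (use assms in auto)
    then show ?thesis using False
      by (simp only: shift power_mult_distrib fps_X_power_mult_nth)
  qed
  then show ?thesis by (simp add: partial_bell_def)
qed

text \<open>
  $B_n^{(c,Y)}(x)$: the sequence of coefficients in the expansion of the generating function
  as a convergent power series in a neighbourhood of $t = 0$. Such a sequence is unique if it
  exists, and it exists if the moment generating function of \<open>Y\<close> is finite near \<open>0\<close>.
\<close>

definition central_bell :: "'a measure \<Rightarrow> ('a \<Rightarrow> real) \<Rightarrow> nat \<Rightarrow> real \<Rightarrow> real" where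
  "central_bell M Y n x =
     (THE b. \<forall>\<^sub>F t in nhds 0. (\<lambda>n. b n * (t ^ n / fact n)) sums
        exp (x * (prob_space.expectation M (\<lambda>\<omega>. exp (Y \<omega> / 2 * t)) -
                  prob_space.expectation M (\<lambda>\<omega>. exp (- (Y \<omega> / 2) * t))))) n"

end

theory Submission
  imports Defs "HOL-Complex_Analysis.Complex_Analysis"
begin

text \<open>
  Dominated convergence turns the moment generating function into the exponential generating
  function of the moments, so the exponent is a power series with coefficients
  $a_m / m!$ and no constant term. The coefficients of its composition with the exponential
  series are by definition sums of partial Bell polynomials, and a convergent real expansion
  is unique. The composition converges because its complexification is holomorphic near $0$.
\<close>

unbundle no vec_syntax
unbundle fps_syntax

text \<open>Passing to complex coefficients makes holomorphy available, from which a composition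
  inherits a positive radius of convergence.\<close>

definition fps_complexify :: "real fps \<Rightarrow> complex fps" where
  "fps_complexify F = Abs_fps (\<lambda>n. of_real (F $ n))"

lemma fps_complexify_nth [simp]: "fps_complexify F $ n = of_real (F $ n)"
  by (simp add: fps_complexify_def)

lemma fps_complexify_mult: "fps_complexify (F * G) = fps_complexify F * fps_complexify G"
  by (simp add: fps_eq_iff fps_mult_nth)

lemma fps_complexify_power: "fps_complexify (F ^ k) = fps_complexify F ^ k"
proof (induction k)
  case 0
  show ?case by (simp add: fps_eq_iff)
qed (simp add: fps_complexify_mult)

lemma fps_complexify_compose:
  "fps_complexify (F oo G) = fps_complexify F oo fps_complexify G"
  by (simp add: fps_eq_iff fps_compose_nth flip: fps_complexify_power)

text \<open>The radius depends only on the norms of the coefficients, which the embedding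
  preserves.\<close>

lemma fps_conv_radius_complexify [simp]:
  "fps_conv_radius (fps_complexify F) = fps_conv_radius F"
  using fps_conv_radius_norm[of "fps_complexify F"] fps_conv_radius_norm[of F] by simp

lemma eval_fps_complexify:
  assumes "ereal \<bar>t\<bar> < fps_conv_radius F"
  shows "eval_fps (fps_complexify F) (of_real t) = of_real (eval_fps F t)"
  using summable_fps[of t F] assms by (simp add: eval_fps_def suminf_of_real)

lemma eventually_nhds_0_conv_radius:
  fixes F :: "'a::{banach, real_normed_div_algebra} fps"
  assumes "fps_conv_radius F > 0"
  shows "eventually (\<lambda>z :: 'a. ereal (norm z) < fps_conv_radius F) (nhds 0)"
proof -
  have "eventually (\<lambda>z. z \<in> eball 0 (fps_conv_radius F)) (nhds (0 :: 'a))"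
    using assms by (intro eventually_nhds_in_open) (auto simp: zero_ereal_def)
  then show ?thesis by simp
qed

text \<open>The complexified series compose as analytic germs, so the complexified composition has
  positive radius, and hence so does \<open>F oo G\<close>. The identity between the complex sums is
  then restricted to the real axis.\<close>

lemma has_fps_expansion_compose_real:
  fixes f g :: "real \<Rightarrow> real"
  assumes f: "f has_fps_expansion F" and g: "g has_fps_expansion G" and G0: "G $ 0 = 0"
  shows "(\<lambda>t. f (g t)) has_fps_expansion (F oo G)"
proof -
  have rF: "fps_conv_radius F > 0" and evF: "\<forall>\<^sub>F t in nhds 0. eval_fps F t = f t"
    and rG: "fps_conv_radius G > 0" and evG: "\<forall>\<^sub>F t in nhds 0. eval_fps G t = g t"
    using f g by (auto simp: has_fps_expansion_def)
  have "(eval_fps (fps_complexify F) \<circ> eval_fps (fps_complexify G))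
          has_fps_expansion (fps_complexify F oo fps_complexify G)"
    using rF rG G0
    by (intro has_fps_expansion_compose eval_fps_has_fps_expansion) auto
  then have rH: "fps_conv_radius (F oo G) > 0"
    and evH: "\<forall>\<^sub>F z in nhds 0. eval_fps (fps_complexify (F oo G)) z =
        eval_fps (fps_complexify F) (eval_fps (fps_complexify G) z)"
    by (auto simp: has_fps_expansion_def simp flip: fps_complexify_compose)
  have "continuous (at 0) g"
    using g by (rule has_fps_expansion_imp_continuous)
  \<comment> \<open>The filter \<open>nhds 0\<close> includes the point itself, so
    \<open>evG\<close> may be read at 0. Then \<open>g\<close> tends to 0 along
    \<open>nhds 0\<close>, and properties that hold near 0 can be pulled back along
    \<open>g\<close>.\<close>
  moreover have "g 0 = 0"
    using evG G0 by (auto dest!: eventually_nhds_x_imp_x simp: eval_fps_at_0)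
  ultimately have g_lim: "filterlim g (nhds 0) (nhds 0)"
    by (metis isCont_def tendsto_at_iff_tendsto_nhds)
  have "filterlim complex_of_real (nhds 0) (nhds 0)"
    using tendsto_of_real[OF filterlim_ident, of 0] by simp
  then have "\<forall>\<^sub>F t in nhds 0. eval_fps (fps_complexify (F oo G)) (of_real t) =
        eval_fps (fps_complexify F) (eval_fps (fps_complexify G) (of_real t))"
    by (rule eventually_compose_filterlim[OF evH])
  moreover have "\<forall>\<^sub>F t in nhds 0. ereal \<bar>g t\<bar> < fps_conv_radius F"
    using eventually_compose_filterlim[OF eventually_nhds_0_conv_radius[OF rF] g_lim] by simp
  moreover have "\<forall>\<^sub>F t in nhds 0. eval_fps F (g t) = f (g t)"
    by (rule eventually_compose_filterlim[OF evF g_lim])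
  moreover note evG eventually_nhds_0_conv_radius[OF rG] eventually_nhds_0_conv_radius[OF rH]
  ultimately have "\<forall>\<^sub>F t in nhds 0. eval_fps (F oo G) t = f (g t)"
  proof eventually_elim
    case (elim t)
    \<comment> \<open>Sums are transferred between the two fields three times: at \<open>t\<close>
      for \<open>F oo G\<close> and \<open>G\<close>, and at \<open>g t\<close> for
      \<open>F\<close>. Each transfer needs its argument inside the disc of convergence.\<close>
    have "complex_of_real (eval_fps (F oo G) t) = of_real (f (g t))"
      using elim eval_fps_complexify[of t "F oo G"] eval_fps_complexify[of t G]
        eval_fps_complexify[of "g t" F] by simp
    then show ?case by simp
  qed
  with rH show ?thesis by (simp add: has_fps_expansion_def)
qed

text \<open>Dividing by the power of z that belongs to the first nonzero coefficient c leaves a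
  series with constant term c. Its sum is continuous at 0 with value c, yet vanishes at every other
  point.\<close>

lemma has_fps_expansion_0_imp_eq_0:
  fixes F :: "'a::{banach, real_normed_field} fps"
  assumes "(\<lambda>_. 0) has_fps_expansion F"
  shows "F = 0"
proof (rule ccontr)
  assume "F \<noteq> 0"
  define c where "c = F $ subdegree F"
  define h where "h = (\<lambda>z :: 'a. if z = 0 then c else 0 / z ^ subdegree F)"
  have "c \<noteq> 0"
    using \<open>F \<noteq> 0\<close> by (simp add: c_def)
  have "h has_fps_expansion fps_shift (subdegree F) F"
    unfolding h_def by (rule has_fps_expansion_shift) (use assms in \<open>auto simp: c_def\<close>)
  then have "continuous (at 0) h"
    by (rule has_fps_expansion_imp_continuous)
  then have "h \<midarrow>0\<rightarrow> c"
    by (simp add: isCont_def h_def)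
  moreover have "h \<midarrow>0\<rightarrow> 0"
    by (rule tendsto_eventually) (auto simp: eventually_at_filter h_def)
  ultimately show False
    using \<open>c \<noteq> 0\<close> by (auto dest: LIM_unique)
qed

lemma has_fps_expansion_unique:
  fixes F G :: "'a::{banach, real_normed_field} fps"
  assumes "f has_fps_expansion F" "f has_fps_expansion G"
  shows "F = G"
  using has_fps_expansion_0_imp_eq_0[of "F - G"] has_fps_expansion_diff[OF assms] by simp

lemma has_fps_expansion_imp_sums:
  fixes F :: "'a::{banach, real_normed_div_algebra} fps"
  assumes "f has_fps_expansion F"
  shows "\<forall>\<^sub>F z in nhds 0. (\<lambda>n. F $ n * z ^ n) sums f z"
proof -
  have "fps_conv_radius F > 0" "\<forall>\<^sub>F z in nhds 0. eval_fps F z = f z"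
    using assms by (auto simp: has_fps_expansion_def)
  from eventually_nhds_0_conv_radius[OF this(1)] this(2) show ?thesis
    by eventually_elim (use sums_eval_fps in force)
qed

lemma exp_abs_le:
  fixes z :: real
  shows "exp \<bar>z\<bar> \<le> exp z + exp (- z)"
  by (simp add: abs_if)

text \<open>The exponential series is integrated term by term. Integrability at both t and -t is
  what makes the majorant \<open>exp (t * Y \<omega>) + exp (- t * Y \<omega>)\<close> of the
  absolute series integrable.\<close>

lemma moments_sums_mgf:
  fixes Y :: "'a \<Rightarrow> real" and t :: real
  assumes [measurable]: "Y \<in> borel_measurable M"
    and int: "integrable M (\<lambda>\<omega>. exp (t * Y \<omega>))" "integrable M (\<lambda>\<omega>. exp (- t * Y \<omega>))"
  shows "(\<lambda>m. (\<integral>\<omega>. Y \<omega> ^ m \<partial>M) * t ^ m / fact m) sums (\<integral>\<omega>. exp (t * Y \<omega>) \<partial>M)"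
proof -
  define f where "f m \<omega> = (t * Y \<omega>) ^ m / fact m" for m \<omega>
  define D where "D \<omega> = exp (t * Y \<omega>) + exp (- t * Y \<omega>)" for \<omega>
  have f_sums: "(\<lambda>m. f m \<omega>) sums exp (t * Y \<omega>)" for \<omega>
    using exp_converges[of "t * Y \<omega>"] by (simp add: f_def divide_inverse mult.commute)
  have norm_f_sums: "(\<lambda>m. norm (f m \<omega>)) sums exp \<bar>t * Y \<omega>\<bar>" for \<omega>
    using exp_converges[of "\<bar>t * Y \<omega>\<bar>"]
    by (simp add: f_def divide_inverse mult.commute abs_mult power_abs)
  \<comment> \<open>Singletons S give the integrability of each term; initial segments bound the
    partial sums of the integrated norms.\<close>
  have bound: "(\<Sum>m\<in>S. norm (f m \<omega>)) \<le> D \<omega>" if "finite S" for S \<omega>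
    using sum_le_suminf[OF sums_summable[OF norm_f_sums] that, of \<omega>]
      sums_unique[OF norm_f_sums, of \<omega>] exp_abs_le[of "t * Y \<omega>"] by (simp add: D_def)
  have D_int: "integrable M D"
    unfolding D_def using int by (rule Bochner_Integration.integrable_add)
  have [measurable]: "f m \<in> borel_measurable M" for m
    unfolding f_def by measurable
  have f_int: "integrable M (f m)" for m
  proof (rule Bochner_Integration.integrable_bound[OF D_int])
    show "AE \<omega> in M. norm (f m \<omega>) \<le> norm (D \<omega>)"
      using bound[of "{m}"] by (auto intro: order_trans[OF _ abs_ge_self])
  qed measurable
  have "summable (\<lambda>m. \<integral>\<omega>. norm (f m \<omega>) \<partial>M)"
  proof (rule summableI_nonneg_bounded)
    fix n
    have "(\<Sum>m<n. \<integral>\<omega>. norm (f m \<omega>) \<partial>M) = (\<integral>\<omega>. (\<Sum>m<n. norm (f m \<omega>)) \<partial>M)"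
      using f_int by (intro Bochner_Integration.integral_sum [symmetric]) auto
    also have "\<dots> \<le> integral\<^sup>L M D"
      using f_int D_int bound by (intro integral_mono) auto
    finally show "(\<Sum>m<n. \<integral>\<omega>. norm (f m \<omega>) \<partial>M) \<le> integral\<^sup>L M D" .
  qed simp
  then have "(\<lambda>m. integral\<^sup>L M (f m)) sums (\<integral>\<omega>. (\<Sum>m. f m \<omega>) \<partial>M)"
    by (intro sums_integral f_int AE_I2 sums_summable[OF norm_f_sums])
  moreover have "(\<Sum>m. f m \<omega>) = exp (t * Y \<omega>)" for \<omega>
    using f_sums by (simp add: sums_iff)
  moreover have "integral\<^sup>L M (f m) = (\<integral>\<omega>. Y \<omega> ^ m \<partial>M) * t ^ m / fact m" for m
  proof -
    have "f m = (\<lambda>\<omega>. t ^ m / fact m * Y \<omega> ^ m)"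
      by (simp add: f_def power_mult_distrib fun_eq_iff)
    then show ?thesis by simp
  qed
  ultimately show ?thesis by simp
qed

text \<open>An expansion settles both halves of the definite description: it provides one admissible
  sequence, and any other one, divided by factorials, expands the same function and so agrees with
  it.\<close>

lemma central_bell_eqI:
  assumes "(\<lambda>t. exp (x * (prob_space.expectation M (\<lambda>\<omega>. exp (Y \<omega> / 2 * t)) -
                  prob_space.expectation M (\<lambda>\<omega>. exp (- (Y \<omega> / 2) * t)))))
           has_fps_expansion F"
    (is "?f has_fps_expansion F")
  shows "central_bell M Y n x = fact n * F $ n"
proof -
  have "(THE b. \<forall>\<^sub>F t in nhds 0. (\<lambda>n. b n * (t ^ n / fact n)) sums ?f t) = (\<lambda>n. fact n * F $ n)"
  proof (rule the_equality)
    show "\<forall>\<^sub>F t in nhds 0. (\<lambda>n. fact n * F $ n * (t ^ n / fact n)) sums ?f t"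
      using has_fps_expansion_imp_sums[OF assms] by simp
  next
    fix b :: "nat \<Rightarrow> real"
    assume "\<forall>\<^sub>F t in nhds 0. (\<lambda>n. b n * (t ^ n / fact n)) sums ?f t"
    then have "?f has_fps_expansion Abs_fps (\<lambda>n. b n / fact n)"
      by (intro has_fps_expansionI) simp
    with assms have "F = Abs_fps (\<lambda>n. b n / fact n)"
      by (rule has_fps_expansion_unique)
    then show "b = (\<lambda>n. fact n * F $ n)"
      by simp
  qed
  then show ?thesis by (simp add: central_bell_def)
qed

text \<open>The factor 1/k! in \<open>partial_bell\<close> is the k-th coefficient of the
  exponential series. As the inner series has no constant term, powers with k > n do not reach
  degree n.\<close>

lemma sum_partial_bell_eq_exp_compose:
  "(\<Sum>k=0..n. partial_bell n k a) =
     fact n * (fps_exp 1 oo Abs_fps (\<lambda>m. if m = 0 then 0 else a m / fact m)) $ n"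
  by (simp add: partial_bell_def fps_compose_nth sum_distrib_left)

theorem theorem2p7:
  fixes M :: "'a measure" and Y :: "'a \<Rightarrow> real" and r x :: real and n :: nat
  assumes "prob_space M"
    and "Y \<in> borel_measurable M"
    and "r > 0"
    and "\<And>t. \<bar>t\<bar> < r \<Longrightarrow> integrable M (\<lambda>\<omega>. exp (t * Y \<omega>))"
  shows "central_bell M Y n x =
    (\<Sum>k=0..n. partial_bell n k
       (\<lambda>m. x * (1 - (-1) ^ m) / 2 ^ m * prob_space.expectation M (\<lambda>\<omega>. Y \<omega> ^ m)))"
proof -
  define a where "a m = x * (1 - (-1) ^ m) / 2 ^ m * (\<integral>\<omega>. Y \<omega> ^ m \<partial>M)" for m
  define A where "A = Abs_fps (\<lambda>m. if m = 0 then 0 else a m / fact m)"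
  define g where "g t = x * ((\<integral>\<omega>. exp (Y \<omega> / 2 * t) \<partial>M) - (\<integral>\<omega>. exp (- (Y \<omega> / 2) * t) \<partial>M))" for t
  \<comment> \<open>The case m = 0 agrees because the factor 1 - (-1)^0 makes \<open>a 0\<close>
    vanish.\<close>
  have A_nth: "A $ m = a m / fact m" for m
    by (simp add: A_def a_def)
  have "(\<lambda>m. A $ m * t ^ m) sums g t" if "\<bar>t\<bar> < r" for t
  proof -
    have mgf: "(\<lambda>m. (\<integral>\<omega>. Y \<omega> ^ m \<partial>M) * s ^ m / fact m) sums (\<integral>\<omega>. exp (s * Y \<omega>) \<partial>M)"
      if "\<bar>s\<bar> < r" for s
      using assms(2) by (rule moments_sums_mgf) (use assms(4)[of s] assms(4)[of "- s"] that in auto)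
    \<comment> \<open>The moment series is taken at t/2 and -t/2, both within the range of radius r.
      In the difference even terms cancel and odd ones double, which produces the factor (1 -
      (-1)^m) / 2^m.\<close>
    have "(\<lambda>m. x * ((\<integral>\<omega>. Y \<omega> ^ m \<partial>M) * (t / 2) ^ m / fact m
              - (\<integral>\<omega>. Y \<omega> ^ m \<partial>M) * (- (t / 2)) ^ m / fact m)) sums
          (x * ((\<integral>\<omega>. exp (t / 2 * Y \<omega>) \<partial>M) - (\<integral>\<omega>. exp (- (t / 2) * Y \<omega>) \<partial>M)))"
      using that by (intro sums_mult sums_diff mgf) auto
    moreover have "x * (E * (t / 2) ^ m / fact m - E * (- (t / 2)) ^ m / fact m) =
        x * (1 - (-1) ^ m) / 2 ^ m * E / fact m * t ^ m" for E m
      by (simp add: power_minus[of "t / 2"] power_divide field_simps)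
    ultimately show ?thesis
      by (simp add: A_nth a_def g_def mult.commute)
  qed
  moreover have "\<forall>\<^sub>F t in nhds 0. \<bar>t\<bar> < r"
    using assms(3) by (auto simp: eventually_nhds_metric dist_norm)
  ultimately have "g has_fps_expansion A"
    by (intro has_fps_expansionI) (auto elim: eventually_mono)
  then have "(\<lambda>t. exp (g t)) has_fps_expansion (fps_exp 1 oo A)"
    by (intro has_fps_expansion_compose_real has_fps_expansion_exp1) (simp_all add: A_def)
  then have "central_bell M Y n x = fact n * (fps_exp 1 oo A) $ n"
    unfolding g_def by (rule central_bell_eqI)
  also have "\<dots> = (\<Sum>k=0..n. partial_bell n k a)"
    by (simp add: A_def sum_partial_bell_eq_exp_compose)
  finally show ?thesis unfolding a_def[abs_def] .
qed

end
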